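(* For each integer $N\ge2$ there exist a polyhedron in $\mathbb R^N$ with less than $2N$ facets and a positive semidefinite quadratic form of rank two such that the restriction of this form to the polyhedron has at least $2^{N-2}$ points of local maxima at which the values of the form are pairwise different.
   Context: A polyhedron is a finite intersection of closed half-spaces (not assumed symmetric). A local maximum is meant relative to the polyhedron. *)

theory Defs
  imports "HOL-Analysis.Analysis"
begin

(* A quadratic form on R^n is represented by its unique symmetric matrix A; the rank of the form is
   the rank of A. *)
definition quad_form :: "real^'n^'n \<Rightarrow> real^'n \<Rightarrow> real"
  where "quad_form A x = x \<bullet> (A *v x)"

definition pos_semidef :: "real^'n^'n \<Rightarrow> bool"
  where "pos_semidef A \<longleftrightarrow> transpose A = A \<and> (\<forall>x. 0 \<le> quad_form A x)"

(* Local maximum of the restriction of f to P (not necessarily strict). *)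
definition local_max_on :: "('a::metric_space \<Rightarrow> real) \<Rightarrow> 'a set \<Rightarrow> 'a \<Rightarrow> bool"
  where "local_max_on f P x \<longleftrightarrow>
    x \<in> P \<and> (\<exists>e>0. \<forall>y\<in>P. dist y x < e \<longrightarrow> f y \<le> f x)"

(* The set of facets of a polyhedron is finite (finite_polyhedron_facets), so its card is the
   genuine number of facets. *)
definition num_facets :: "'a::euclidean_space set \<Rightarrow> nat"
  where "num_facets P = card {F. F facet_of P}"

end

theory Submission
  imports Defs
begin

text \<open>
  Let \<open>g\<close> be the piecewise linear interpolation of \<open>x \<mapsto> - x\<^sup>2\<close> at the points \<open>k / 2^m\<close> of \<open>[0,1]\<close>.
  Then \<open>x\<^sup>2 + g x\<close> has a strict local maximum at every inner node. By the sawtooth identity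
  \<open>g x = - x + \<Sum>s=1..m. t s / 4^s\<close>, where \<open>t 0 = x\<close> and \<open>t (s + 1) = min (2 * t s) (2 - 2 * t s)\<close>,
  the hypograph of \<open>g\<close> is the planar image of the polyhedron in \<open>m + 1\<close> variables defined by the
  \<open>2 * m\<close> inequalities \<open>t (s + 1) \<le> 2 * t s\<close> and \<open>t (s + 1) \<le> 2 - 2 * t s\<close>: lowering some \<open>t s\<close> never pays,
  as the later terms gain less than is lost. Writing \<open>y\<close> for the height and \<open>R\<close> for a large number,
  \<open>2 * R * x\<^sup>2 + (R + y)\<^sup>2 = R\<^sup>2 + 2 * R * (x\<^sup>2 + y) + y\<^sup>2\<close>, which becomes a quadratic form of rank two
  after a translation. The term \<open>y\<^sup>2\<close> is a small perturbation that preserves the local maxima and makes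
  the values \<open>R\<^sup>2 + x^4\<close> at the nodes pairwise different.
\<close>

section \<open>Facets of a finite intersection of half-spaces\<close>

text \<open>A subfamily of least size that still cuts \<open>P\<close> out of its affine hull is
  irredundant. For such a family the facets are exactly the intersections of \<open>P\<close> with
  the bounding hyperplanes.\<close>

lemma num_facets_halfspaces_le:
  fixes P :: "'a::euclidean_space set"
  assumes "finite H" and P: "P = \<Inter>H"
    and H: "\<And>h. h \<in> H \<Longrightarrow> \<exists>a b. a \<noteq> 0 \<and> h = {x. a \<bullet> x \<le> b}"
  shows "num_facets P \<le> card H"
proof -
  let ?Q = "\<lambda>F. F \<subseteq> H \<and> P = affine hull P \<inter> \<Inter>F"
  have "?Q H"
    using P hull_subset[of P affine] by auto
  then obtain F where F: "?Q F" and least: "\<And>F'. ?Q F' \<Longrightarrow> card F \<le> card F'"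
    using ex_has_least_nat[of ?Q H card] by blast
  have "finite F"
    using F \<open>finite H\<close> finite_subset by blast
  obtain a b where ab: "\<And>h. h \<in> F \<Longrightarrow> a h \<noteq> 0 \<and> h = {x. a h \<bullet> x \<le> b h}"
    using H F by (metis subsetD)
  have psub: "P \<subset> affine hull P \<inter> \<Inter>F'" if "F' \<subset> F" for F'
  proof -
    have "card F' < card F"
      using that \<open>finite F\<close> by (rule psubset_card_mono[rotated])
    then have "P \<noteq> affine hull P \<inter> \<Inter>F'"
      using least[of F'] F that by fastforce
    then show ?thesis
      using F that by blast
  qed
  have "{C. C facet_of P} = (\<lambda>h. P \<inter> {x. a h \<bullet> x = b h}) ` F"
    using facet_of_polyhedron_explicit[OF \<open>finite F\<close> _ ab psub] F by auto
  then have "num_facets P \<le> card F"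
    unfolding num_facets_def using \<open>finite F\<close> by (simp add: card_image_le)
  also have "\<dots> \<le> card H"
    using F \<open>finite H\<close> by (simp add: card_mono)
  finally show ?thesis .
qed

section \<open>The sawtooth polyhedron and the height on it\<close>

definition tent_coeff :: "nat \<Rightarrow> real"
  where "tent_coeff s = (if s = 0 then - 1 else 1 / 4 ^ s)"

definition tent_height :: "nat \<Rightarrow> (nat \<Rightarrow> real) \<Rightarrow> real"
  where "tent_height m t = (\<Sum>s\<le>m. tent_coeff s * t s)"

definition tent_feasible :: "nat \<Rightarrow> (nat \<Rightarrow> real) \<Rightarrow> bool"
  where "tent_feasible m t \<longleftrightarrow> (\<forall>s<m. t (Suc s) \<le> 2 * t s \<and> t (Suc s) \<le> 2 - 2 * t s)"

lemma tent_height_Suc: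
  "tent_height (Suc m) t = - t 0 + t 1 / 2 + tent_height m (\<lambda>s. t (Suc s)) / 4"
proof -
  \<comment> \<open>Shifting the index divides the coefficients by 4 except at \<open>s = 0\<close>,
    where 1/4 stands against -1/4; the difference is the extra \<open>t 1 / 2\<close>.\<close>
  have "tent_coeff (Suc s) * t (Suc s) =
      (if s = 0 then t 1 / 2 else 0) + tent_coeff s * t (Suc s) / 4" for s
    by (simp add: tent_coeff_def)
  then have "(\<Sum>s\<le>m. tent_coeff (Suc s) * t (Suc s)) =
      t 1 / 2 + (\<Sum>s\<le>m. tent_coeff s * t (Suc s)) / 4"
    by (simp add: sum.distrib sum_divide_distrib)
  then show ?thesis
    unfolding tent_height_def by (subst sum.atMost_Suc_shift) (simp add: tent_coeff_def)
qed

lemma tent_feasible_Suc: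
  "tent_feasible (Suc m) t \<longleftrightarrow>
    t 1 \<le> 2 * t 0 \<and> t 1 \<le> 2 - 2 * t 0 \<and> tent_feasible m (\<lambda>s. t (Suc s))"
  unfolding tent_feasible_def by (auto simp: All_less_Suc2)

text \<open>The right-hand side is the chord of \<open>x \<mapsto> - x\<^sup>2\<close> between the nodes \<open>j / 2^m\<close> and \<open>(j + 1) / 2^m\<close>.\<close>

lemma tent_height_le_chord:
  assumes "tent_feasible m t" "j < 2 ^ m"
  shows "tent_height m t \<le> - (2 * real j + 1) / 2 ^ m * t 0 + real j * (real j + 1) / (2 ^ m)\<^sup>2"
  using assms
proof (induction m arbitrary: t j)
  case 0
  then show ?case
    by (simp add: tent_height_def tent_coeff_def)
next
  case (Suc m)
  \<comment> \<open>The mesh of the finer grid; the induction hypothesis speaks of the grid with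
    mesh \<open>2 * h\<close>.\<close>
  define h :: real where "h = 1 / 2 ^ Suc m"
  have h: "h > 0" "2 ^ Suc m * h = 1" "1 / 2 ^ m = 2 * h"
    by (simp_all add: h_def)
  have t: "t 1 \<le> 2 * t 0" "t 1 \<le> 2 - 2 * t 0" "tent_feasible m (\<lambda>s. t (Suc s))"
    using Suc.prems(1) by (simp_all add: tent_feasible_Suc)
  have IH: "tent_height (Suc m) t
      \<le> - t 0 + t 1 * (1 / 2 - (2 * real i + 1) * h / 2) + real i * (real i + 1) * h\<^sup>2"
    if "i < 2 ^ m" for i
  proof -
    have "tent_height m (\<lambda>s. t (Suc s)) \<le> - (2 * real i + 1) * (1 / 2 ^ m) * t 1
        + real i * (real i + 1) * (1 / 2 ^ m)\<^sup>2"
      using Suc.IH[OF t(3) that] by (simp add: power_divide)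
    moreover have "- (2 * real i + 1) * (1 / 2 ^ m) * t 1 + real i * (real i + 1) * (1 / 2 ^ m)\<^sup>2
      = 4 * (real i * (real i + 1) * h\<^sup>2 - t 1 * ((2 * real i + 1) * h / 2))"
      unfolding h(3) by (simp add: field_simps power2_eq_square)
    ultimately show ?thesis
      unfolding tent_height_Suc by (simp add: right_diff_distrib)
  qed
  \<comment> \<open>Since the coefficient of \<open>t 1\<close> in \<open>IH\<close> is nonnegative,
    \<open>t 1\<close> may be replaced by either of its upper bounds: \<open>2 * t 0\<close> for
    chords in the left half, \<open>2 - 2 * t 0\<close> for chords in the right half.\<close>
  have coeff: "0 \<le> 1 / 2 - (2 * real i + 1) * h / 2" if "i < 2 ^ m" for i
  proof -
    have "2 * i + 1 \<le> 2 ^ Suc m"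
      using that by simp
    then have "real (2 * i + 1) \<le> real (2 ^ Suc m)"
      by (simp only: of_nat_le_iff)
    then have "2 * real i + 1 \<le> 2 ^ Suc m"
      by simp
    then have "(2 * real i + 1) * h \<le> 2 ^ Suc m * h"
      using h(1) by (intro mult_right_mono) auto
    then show ?thesis
      using h(2) by simp
  qed
  have "tent_height (Suc m) t \<le> - (2 * real j + 1) * h * t 0 + real j * (real j + 1) * h\<^sup>2"
  proof (cases "j < 2 ^ m")
    case True
    have "t 1 * (1 / 2 - (2 * real j + 1) * h / 2)
        \<le> (2 * t 0) * (1 / 2 - (2 * real j + 1) * h / 2)"
      by (rule mult_right_mono[OF t(1) coeff[OF True]])
    moreover have "- t 0 + (2 * t 0) * (1 / 2 - (2 * real j + 1) * h / 2)
        = - (2 * real j + 1) * h * t 0"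
      by (simp add: algebra_simps)
    ultimately show ?thesis
      using IH[OF True] by linarith
  next
    case False
    \<comment> \<open>The reflection x -> 1 - x takes the j-th interval of the fine grid to the
      i-th, which doubling takes to the i-th interval of the coarse grid.\<close>
    define i where "i = 2 ^ Suc m - 1 - j"
    have i: "i < 2 ^ m"
      using False Suc.prems(2) by (simp add: i_def)
    have "j + i + 1 = 2 ^ Suc m"
      using Suc.prems(2) by (simp add: i_def)
    then have "real (j + i + 1) = real (2 ^ Suc m)"
      by (simp only:)
    then have "real j + real i + 1 = 2 ^ Suc m"
      by simp
    then have "(real j + real i + 1) * h = 1"
      using h(2) by (simp only:)
    then have jh: "real j * h = 1 - h - real i * h"
      by (simp add: algebra_simps)
    have "t 1 * (1 / 2 - (2 * real i + 1) * h / 2)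
        \<le> (2 - 2 * t 0) * (1 / 2 - (2 * real i + 1) * h / 2)"
      by (rule mult_right_mono[OF t(2) coeff[OF i]])
    moreover have "- t 0 + (2 - 2 * t 0) * (1 / 2 - (2 * real i + 1) * h / 2)
        + real i * (real i + 1) * h\<^sup>2
      = - (2 * (real j * h) + h) * t 0 + (real j * h) * (real j * h + h)"
      unfolding jh by (simp add: field_simps power2_eq_square)
    moreover have "- (2 * (real j * h) + h) * t 0 + (real j * h) * (real j * h + h)
      = - (2 * real j + 1) * h * t 0 + real j * (real j + 1) * h\<^sup>2"
      by (simp add: algebra_simps power2_eq_square)
    ultimately show ?thesis
      using IH[OF i] by linarith
  qed
  then show ?case
    by (simp add: h_def power_divide)
qed

text \<open>The orbit of a node under the tent map makes one of the two inequalities tight at each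
  step, and the tent map sends nodes to nodes of the next coarser grid.\<close>

lemma tent_height_attained:
  assumes "k \<le> 2 ^ m"
  shows "\<exists>t. tent_feasible m t \<and> t 0 = real k / 2 ^ m \<and> tent_height m t = - (real k / 2 ^ m)\<^sup>2"
  using assms
proof (induction m arbitrary: k)
  case 0
  then have "k = 0 \<or> k = 1"
    by auto
  then show ?case
    by (intro exI[of _ "\<lambda>_. real k"]) (auto simp: tent_feasible_def tent_height_def tent_coeff_def)
next
  case (Suc m)
  define x where "x = real k / 2 ^ Suc m"
  define i where "i = (if k \<le> 2 ^ m then k else 2 ^ Suc m - k)"
  have "i \<le> 2 ^ m"
    by (auto simp: i_def)
  define w where "w = real i / 2 ^ m"
  obtain t where t: "tent_feasible m t" "t 0 = w" "tent_height m t = - w\<^sup>2"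
    using Suc.IH[OF \<open>i \<le> 2 ^ m\<close>] unfolding w_def by blast
  have cases: "w = 2 * x \<and> 2 * x \<le> 1 \<or> w = 2 - 2 * x \<and> 2 * x \<ge> 1"
  proof (cases "k \<le> 2 ^ m")
    case True
    then have "real k \<le> 2 ^ m"
      by (metis of_nat_le_iff of_nat_numeral of_nat_power)
    then show ?thesis
      using True by (simp add: w_def i_def x_def)
  next
    case False
    then have "real k \<ge> 2 ^ m"
      by (metis nle_le of_nat_le_iff of_nat_numeral of_nat_power)
    moreover have "real i = 2 * 2 ^ m - real k"
      using False Suc.prems by (simp add: i_def of_nat_diff)
    ultimately show ?thesis
      by (simp add: w_def x_def field_simps)
  qed
  let ?t = "case_nat x t"
  have "tent_feasible (Suc m) ?t"
    using t cases by (auto simp: tent_feasible_Suc)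
  moreover have "tent_height (Suc m) ?t = - x\<^sup>2"
  proof -
    \<comment> \<open>Expanded, this says - x + w/2 - w^2/4 = - x^2, which covers both branches of
      the tent map at once.\<close>
    have "(w - 2 * x) * (w + 2 * x - 2) = 0"
      using cases by auto
    then show ?thesis
      unfolding tent_height_Suc by (simp add: t power2_eq_square algebra_simps)
  qed
  ultimately show ?case
    unfolding x_def by (metis old.nat.simps(4))
qed

section \<open>Stability of the maxima under the quadratic perturbation\<close>

text \<open>With \<open>v\<close> the bound on the change of height, the kink at the node
  contributes - 2 R h |u| = - 8 |u|. Against it stand - 2 x^2 v <= 6 |u| and 2 R u^2 + v^2 <= (2 R +
  9) u^2 <= 2 |u|. The hypothesis \<open>0 \<le> R + y\<close> allows the bound on the height to be
  squared.\<close>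

lemma perturbed_node_le:
  fixes R h x u y :: real
  assumes R: "R * h = 4" "0 < h" and h: "h \<le> 1" and x: "0 \<le> x" "x \<le> 1"
    and u: "(2 * R + 9) * \<bar>u\<bar> \<le> 2"
    and y: "y \<le> - x\<^sup>2 - 2 * x * u - h * \<bar>u\<bar>" "0 \<le> R + y"
  shows "2 * R * (x + u)\<^sup>2 + (R + y)\<^sup>2 \<le> 2 * R * x\<^sup>2 + (R - x\<^sup>2)\<^sup>2"
proof -
  define v where "v = - 2 * x * u - h * \<bar>u\<bar>"
  have "\<bar>v\<bar> \<le> \<bar>2 * x * u\<bar> + \<bar>h * \<bar>u\<bar>\<bar>"
    unfolding v_def by linarith
  also have "\<dots> = 2 * (x * \<bar>u\<bar>) + h * \<bar>u\<bar>"
    using x \<open>0 < h\<close> by (simp add: abs_mult)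
  also have "\<dots> \<le> 2 * (1 * \<bar>u\<bar>) + 1 * \<bar>u\<bar>"
    using x h by (intro add_mono mult_left_mono mult_right_mono) auto
  finally have v: "\<bar>v\<bar> \<le> 3 * \<bar>u\<bar>"
    by simp
  have "v\<^sup>2 \<le> (3 * \<bar>u\<bar>)\<^sup>2"
    using v by (metis abs_ge_zero power2_abs power_mono)
  moreover have "- (x\<^sup>2 * v) \<le> 1 * (3 * \<bar>u\<bar>)"
  proof -
    have "- (x\<^sup>2 * v) \<le> x\<^sup>2 * \<bar>v\<bar>"
      by (metis abs_ge_minus_self abs_mult abs_power2)
    also have "\<dots> \<le> 1 * (3 * \<bar>u\<bar>)"
      using v x by (intro mult_mono) (auto simp: power_le_one)
    finally show ?thesis .
  qed
  moreover have "((2 * R + 9) * \<bar>u\<bar>) * \<bar>u\<bar> \<le> 2 * \<bar>u\<bar>"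
    using u by (intro mult_right_mono) auto
  moreover have "(R + y)\<^sup>2 \<le> (R - x\<^sup>2 + v)\<^sup>2"
    using y by (intro power_mono) (auto simp: v_def)
  moreover have "2 * R * (x + u)\<^sup>2 + (R - x\<^sup>2 + v)\<^sup>2
    = 2 * R * x\<^sup>2 + (R - x\<^sup>2)\<^sup>2 + 2 * R * u\<^sup>2 - 2 * (R * h) * \<bar>u\<bar> - 2 * (x\<^sup>2 * v) + v\<^sup>2"
    unfolding v_def by (simp add: algebra_simps power2_eq_square)
  moreover have "((2 * R + 9) * \<bar>u\<bar>) * \<bar>u\<bar> = 2 * R * u\<^sup>2 + (3 * \<bar>u\<bar>)\<^sup>2"
    by (simp add: algebra_simps power2_eq_square)
  ultimately show ?thesis
    using R(1) by simp
qed

section \<open>Quadratic forms that are sums of two squares\<close>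

definition two_squares_matrix :: "real \<Rightarrow> real^'n \<Rightarrow> real^'n \<Rightarrow> real^'n^'n"
  where "two_squares_matrix c a b = (\<chi> i j. c * a $ i * a $ j + b $ i * b $ j)"

lemma two_squares_matrix_mult:
  "two_squares_matrix c a b *v x = (c * (a \<bullet> x)) *\<^sub>R a + (b \<bullet> x) *\<^sub>R b"
  by (simp add: two_squares_matrix_def vec_eq_iff matrix_vector_mult_def inner_vec_def
      algebra_simps sum.distrib sum_distrib_left)

lemma quad_form_two_squares_matrix:
  "quad_form (two_squares_matrix c a b) x = c * (a \<bullet> x)\<^sup>2 + (b \<bullet> x)\<^sup>2"
  by (simp add: quad_form_def two_squares_matrix_mult inner_right_distrib inner_commute
      power2_eq_square)

lemma pos_semidef_two_squares_matrix:
  assumes "0 \<le> c"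
  shows "pos_semidef (two_squares_matrix c a b)"
proof -
  have "transpose (two_squares_matrix c a b) = two_squares_matrix c a b"
    by (simp add: two_squares_matrix_def transpose_def vec_eq_iff mult.commute mult.left_commute)
  then show ?thesis
    using assms by (simp add: pos_semidef_def quad_form_two_squares_matrix)
qed

text \<open>The vector \<open>p\<close> is mapped to a nonzero multiple of \<open>b\<close>; once
  \<open>b\<close> is in the range, the image of \<open>q\<close> yields \<open>a\<close>. As
  \<open>p\<close> is orthogonal to \<open>a\<close> but not to \<open>b\<close>, it also shows that
  \<open>b\<close> is no multiple of \<open>a\<close>.\<close>

lemma rank_two_squares_matrix:
  fixes a b p q :: "real^'n"
  assumes "c \<noteq> 0" "a \<bullet> p = 0" "b \<bullet> p \<noteq> 0" "a \<bullet> q \<noteq> 0"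
  shows "rank (two_squares_matrix c a b) = 2"
proof -
  let ?A = "two_squares_matrix c a b"
  let ?V = "range ((*v) ?A)"
  have V: "subspace ?V"
    by (rule linear_subspace_image[OF matrix_vector_mul_linear subspace_UNIV])
  have "?A *v p \<in> ?V"
    by simp
  then have "(1 / (b \<bullet> p)) *\<^sub>R (?A *v p) \<in> ?V"
    using V subspace_scale by blast
  then have b: "b \<in> ?V"
    using assms by (simp add: two_squares_matrix_mult)
  have "?A *v q - (b \<bullet> q) *\<^sub>R b \<in> ?V"
    using b V by (intro subspace_diff subspace_scale) auto
  then have "(1 / (c * (a \<bullet> q))) *\<^sub>R (?A *v q - (b \<bullet> q) *\<^sub>R b) \<in> ?V"
    using V subspace_scale by blast
  then have a: "a \<in> ?V"
    using assms by (simp add: two_squares_matrix_mult)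
  have "span {a, b} \<subseteq> ?V"
    using a b V by (intro span_minimal insert_subsetI empty_subsetI)
  moreover have "?V \<subseteq> span {a, b}"
    unfolding two_squares_matrix_mult by (intro image_subsetI span_add span_scale span_base) auto
  ultimately have V_eq: "?V = span {a, b}"
    by auto
  have "a \<noteq> 0"
    using assms by auto
  moreover have "b \<notin> span {a}"
    using assms by (auto simp: span_singleton)
  ultimately have "independent {b, a}"
    by (simp add: independent_insert)
  moreover have "a \<noteq> b"
    using assms by auto
  ultimately have "dim {a, b} = 2"
    by (simp add: dim_eq_card_independent insert_commute)
  then show ?thesis
    by (simp add: rank_dim_range V_eq)
qed

section \<open>Assembling the polyhedron, the form and the maxima\<close>

theorem theorem3p4:
  assumes "CARD('n::finite) \<ge> 2"
  shows "\<exists>(P :: (real^'n) set) (A :: real^'n^'n).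
    polyhedron P \<and> num_facets P < 2 * CARD('n) \<and>
    pos_semidef A \<and> rank A = 2 \<and>
    (\<exists>S. finite S \<and> card S \<ge> 2 ^ (CARD('n) - 2) \<and>
         (\<forall>x\<in>S. local_max_on (quad_form A) P x) \<and>
         inj_on (quad_form A) S)"
proof -
  define m where "m = CARD('n) - 1"
  have m: "m > 0" "CARD('n) = Suc m" "CARD('n) - 2 = m - 1"
    using assms by (simp_all add: m_def)
  have "{0..<CARD('n)} = {..m}"
    using m by auto
  then obtain f :: "nat \<Rightarrow> 'n" where f: "bij_betw f {..m} UNIV"
    using ex_bij_betw_nat_finite[of "UNIV :: 'n set"] by auto
  define f' where "f' = inv_into {..m} f"
  have f'f: "f' (f s) = s" if "s \<le> m" for s
    unfolding f'_def using f that by (simp add: bij_betw_inv_into_left)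
  have f_eq: "f s = f r \<longleftrightarrow> s = r" if "s \<le> m" "r \<le> m" for s r
    using f'f that by metis
  define h :: real where "h = 1 / 2 ^ m"
  define R :: real where "R = 4 * 2 ^ m"
  have h: "0 < h" "h \<le> 1" "R * h = 4" and R: "0 < R"
    by (simp_all add: h_def R_def)
  define a :: "real^'n" where "a = axis (f 0) 1"
  define b :: "real^'n" where "b = (\<chi> i. tent_coeff (f' i))"
  \<comment> \<open>Translating by \<open>p\<close> raises the height by exactly \<open>R\<close>,
    the last coordinate having weight \<open>1 / 4 ^ m\<close>, and leaves \<open>t 0\<close> fixed
    because \<open>m > 0\<close>.\<close>
  define p :: "real^'n" where "p = axis (f m) (4 ^ m * R)"
  have a_inner: "a \<bullet> z = z $ f 0" for z
    by (simp add: a_def inner_axis')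
  have b_inner: "b \<bullet> z = tent_height m (\<lambda>s. z $ f s)" for z
  proof -
    have "b \<bullet> z = (\<Sum>s\<le>m. b $ f s * z $ f s)"
      by (simp add: inner_vec_def sum.reindex_bij_betw[OF f, of "\<lambda>i. b $ i * z $ i"])
    then show ?thesis
      by (simp add: tent_height_def b_def f'f)
  qed
  have ap: "a \<bullet> p = 0"
    using m(1) by (simp add: a_inner p_def axis_def f_eq)
  have bp: "b \<bullet> p = R"
    using m(1) by (simp add: p_def inner_axis b_def f'f tent_coeff_def)
  define A where "A = two_squares_matrix (2 * R) a b"
  define P where "P = {z. tent_feasible m (\<lambda>s. (z - p) $ f s)}"
  define c1 where "c1 s = (axis (f (Suc s)) 1 - 2 *\<^sub>R axis (f s) 1 :: real^'n)" for s
  define c2 where "c2 s = (axis (f (Suc s)) 1 + 2 *\<^sub>R axis (f s) 1 :: real^'n)" for s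
  define H where "H = (\<lambda>s. {z. c1 s \<bullet> z \<le> c1 s \<bullet> p}) ` {..<m}
    \<union> (\<lambda>s. {z. c2 s \<bullet> z \<le> 2 + c2 s \<bullet> p}) ` {..<m}"
  have c_inner: "c1 s \<bullet> z = z $ f (Suc s) - 2 * z $ f s"
    "c2 s \<bullet> z = z $ f (Suc s) + 2 * z $ f s" for s z
    by (simp_all add: c1_def c2_def inner_diff_left inner_add_left inner_axis')
  have "c1 s \<noteq> 0 \<and> c2 s \<noteq> 0" if "s < m" for s
  proof -
    have "c1 s \<bullet> axis (f (Suc s)) 1 = 1" "c2 s \<bullet> axis (f (Suc s)) 1 = 1"
      unfolding c_inner using that by (simp_all add: axis_def f_eq)
    then show ?thesis
      by auto
  qed
  then have H: "\<exists>a b. a \<noteq> 0 \<and> h = {x. a \<bullet> x \<le> b}" if "h \<in> H" for h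
    using that unfolding H_def by blast
  have "finite H"
    by (simp add: H_def)
  have P_eq: "P = \<Inter>H"
  proof -
    have "(z - p) $ f (Suc s) \<le> 2 * (z - p) $ f s \<longleftrightarrow> c1 s \<bullet> z \<le> c1 s \<bullet> p" for z s
      unfolding c_inner vector_minus_component by (simp add: algebra_simps)
    moreover have "(z - p) $ f (Suc s) \<le> 2 - 2 * (z - p) $ f s \<longleftrightarrow> c2 s \<bullet> z \<le> 2 + c2 s \<bullet> p" for z s
      unfolding c_inner vector_minus_component by (simp add: algebra_simps)
    ultimately show ?thesis
      unfolding P_def H_def tent_feasible_def by blast
  qed
  have "card (g ` {..<m}) \<le> m" for g :: "nat \<Rightarrow> (real^'n) set"
    using card_image_le[of "{..<m}" g] by simp
  then have "card H \<le> m + m"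
    unfolding H_def by (intro order.trans[OF card_Un_le] add_mono)
  then have facets: "num_facets P < 2 * CARD('n)"
    using num_facets_halfspaces_le[OF \<open>finite H\<close> P_eq H] m(2) by simp
  have poly: "polyhedron P"
    unfolding polyhedron_def using \<open>finite H\<close> P_eq H by blast
  have "rank A = 2"
    unfolding A_def using R ap bp
    by (intro rank_two_squares_matrix[where p = p and q = a]) (auto simp: a_def inner_axis')
  define node where "node k = real k * h" for k
  have "\<exists>z\<in>P. a \<bullet> z = node k \<and> b \<bullet> z = R - (node k)\<^sup>2" if k: "k < 2 ^ m" for k
  proof -
    obtain t where t: "tent_feasible m t" "t 0 = node k" "tent_height m t = - (node k)\<^sup>2"
      using tent_height_attained[of k m] k by (auto simp: node_def h_def)
    define z where "z = p + (\<chi> i. t (f' i))"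
    have zp: "(z - p) $ f s = t s" if "s \<le> m" for s
      using that by (simp add: z_def f'f)
    have "z \<in> P"
      using t(1) by (simp add: P_def tent_feasible_def zp del: vector_minus_component)
    moreover have "a \<bullet> (z - p) = node k"
      using t(2) by (simp add: a_inner zp del: vector_minus_component)
    moreover have "b \<bullet> (z - p) = - (node k)\<^sup>2"
      using t(3) by (simp add: b_inner tent_height_def zp del: vector_minus_component)
    ultimately show ?thesis
      using ap bp by (intro bexI[of _ z]) (simp_all add: inner_diff_right)
  qed
  then obtain Z where Z: "\<And>k. k < 2 ^ m \<Longrightarrow>
      Z k \<in> P \<and> a \<bullet> Z k = node k \<and> b \<bullet> Z k = R - (node k)\<^sup>2"
    by metis
  \<comment> \<open>Only inner nodes, so that the chords \<open>k - 1\<close> and \<open>k\<close>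
    on both sides exist.\<close>
  let ?K = "{1..<2 ^ m} :: nat set"
  have qf: "quad_form A z = 2 * R * (a \<bullet> z)\<^sup>2 + (b \<bullet> z)\<^sup>2" for z
    by (simp add: A_def quad_form_two_squares_matrix)
  have node01: "0 \<le> node k" "node k \<le> 1" if "k < 2 ^ m" for k
  proof -
    have "real k \<le> 2 ^ m"
      using that by (metis less_imp_le of_nat_le_iff of_nat_numeral of_nat_power)
    then show "0 \<le> node k" "node k \<le> 1"
      by (simp_all add: node_def h_def)
  qed
  have val: "quad_form A (Z k) = R\<^sup>2 + (node k) ^ 4" if "k < 2 ^ m" for k
  proof -
    have "quad_form A (Z k) = 2 * R * (node k)\<^sup>2 + (R - (node k)\<^sup>2)\<^sup>2"
      using Z[OF that] by (simp add: qf)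
    also have "\<dots> = R\<^sup>2 + (node k) ^ 4"
      by (simp add: algebra_simps eval_nat_numeral)
    finally show ?thesis .
  qed
  have inj_val: "inj_on (\<lambda>k. quad_form A (Z k)) ?K"
  proof (rule inj_onI)
    fix k l assume *: "k \<in> ?K" "l \<in> ?K" "quad_form A (Z k) = quad_form A (Z l)"
    then have "node k ^ 4 = node l ^ 4"
      using val by simp
    then have "node k = node l"
      using * node01 by (intro power_eq_imp_eq_base[of "node k" 4 "node l"]) auto
    then show "k = l"
      using h(1) by (simp add: node_def)
  qed
  then have "inj_on Z ?K"
    by (auto simp: inj_on_def)
  then have "card (Z ` ?K) = 2 ^ m - 1"
    by (simp add: card_image)
  moreover have "(2::nat) ^ (m - 1) \<le> 2 ^ m - 1"
    using m(1) by (cases m) (auto simp: Suc_leI)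
  ultimately have card: "2 ^ (CARD('n) - 2) \<le> card (Z ` ?K)"
    using m(3) by simp
  have "inj_on (quad_form A) (Z ` ?K)"
    using inj_val by (auto simp: inj_on_def)
  moreover have "local_max_on (quad_form A) P (Z k)" if "k \<in> ?K" for k
  proof -
    have k: "k < 2 ^ m" "k - 1 < 2 ^ m" "real (k - 1) = real k - 1"
      using that by (auto simp: of_nat_diff)
    define x where "x = node k"
    have x: "x = real k * h"
      by (simp add: x_def node_def)
    have x01: "0 \<le> x" "x \<le> 1"
      using node01[OF k(1)] by (simp_all add: x_def)
    \<comment> \<open>The first bound gives the smallness of \<open>u\<close> needed in
      \<open>perturbed_node_le\<close>; the second keeps \<open>b \<bullet> z\<close> within 1 of R
      - x^2, hence nonnegative.\<close>
    define e where "e = min (2 / (2 * R + 9)) (1 / (norm b + 1))"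
    have "0 < norm b + 1"
      by (simp add: add_nonneg_pos)
    then have "e > 0"
      using R by (simp add: e_def)
    moreover have "quad_form A z \<le> quad_form A (Z k)" if z: "z \<in> P" and d: "dist z (Z k) < e" for z
    proof -
      define u where "u = a \<bullet> (z - Z k)"
      define y where "y = b \<bullet> (z - p)"
      have "\<bar>u\<bar> \<le> norm a * norm (z - Z k)"
        unfolding u_def by (rule Cauchy_Schwarz_ineq2)
      also have "\<dots> < 2 / (2 * R + 9)"
        using d by (simp add: a_def e_def dist_norm)
      finally have u: "(2 * R + 9) * \<bar>u\<bar> \<le> 2"
        using R by (simp add: field_simps)
      have "\<bar>b \<bullet> (z - Z k)\<bar> \<le> norm b * norm (z - Z k)"
        by (rule Cauchy_Schwarz_ineq2)
      also have "\<dots> \<le> (norm b + 1) * (1 / (norm b + 1))"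
        using d by (intro mult_mono) (auto simp: e_def dist_norm)
      also have "\<dots> = 1"
        using \<open>0 < norm b + 1\<close> by simp
      finally have "\<bar>b \<bullet> z - (R - x\<^sup>2)\<bar> \<le> 1"
        using Z[OF k(1)] by (simp add: inner_diff_right x_def)
      moreover have "x\<^sup>2 \<le> 1"
        using x01 by (simp add: power_le_one)
      moreover have "R \<ge> 4"
        by (simp add: R_def)
      ultimately have "0 \<le> b \<bullet> z"
        by linarith
      then have Ry: "0 \<le> R + y" "b \<bullet> z = R + y"
        by (simp_all add: y_def inner_diff_right bp)
      have az: "a \<bullet> z = x + u"
        using Z[OF k(1)] by (simp add: u_def x_def inner_diff_right)
      have feas: "tent_feasible m (\<lambda>s. (z - p) $ f s)"
        using z by (simp add: P_def)
      have y_le: "y \<le> - (2 * real j + 1) * h * (x + u) + real j * (real j + 1) * h\<^sup>2"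
        if "j < 2 ^ m" for j
      proof -
        have "(z - p) $ f 0 = x + u"
          using ap az by (simp flip: a_inner add: inner_diff_right)
        then show ?thesis
          using tent_height_le_chord[OF feas that]
          by (simp add: y_def b_inner h_def power_divide del: vector_minus_component)
      qed
      \<comment> \<open>The two chords meeting at the node, of slopes - 2 x - h and - 2 x + h; their
        minimum produces the term \<open>- h * \<bar>u\<bar>\<close>.\<close>
      have "y \<le> - x\<^sup>2 - 2 * x * u - h * u" "y \<le> - x\<^sup>2 - 2 * x * u + h * u"
        using y_le[OF k(1)] y_le[OF k(2)] unfolding k(3) x
        by (simp_all add: algebra_simps power2_eq_square)
      then have "y \<le> - x\<^sup>2 - 2 * x * u - h * \<bar>u\<bar>"
        by (cases "u \<ge> 0") auto
      then have "2 * R * (x + u)\<^sup>2 + (R + y)\<^sup>2 \<le> 2 * R * x\<^sup>2 + (R - x\<^sup>2)\<^sup>2"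
        using h x01 u Ry(1) by (intro perturbed_node_le[where h = h]) auto
      then show ?thesis
        using Z[OF k(1)] by (simp add: qf az Ry(2) x_def)
    qed
    ultimately show ?thesis
      unfolding local_max_on_def using Z[OF k(1)] by blast
  qed
  moreover have "pos_semidef A"
    unfolding A_def using R by (intro pos_semidef_two_squares_matrix) simp
  ultimately show ?thesis
    using poly facets \<open>rank A = 2\<close> card by (intro exI[of _ P] exI[of _ A] conjI exI[of _ "Z ` ?K"]) auto
qed

end
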